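(* Let $\mathcal{A} := (A, [\,,\,], [\,,\,,\,], \beta)$ be a multiplicative Hom-Akivis algebra. For each integer $n \geq 0$, define on $A$ a binary operation $[\,,\,]_n$ and a ternary operation $[\,,\,,\,]_n$ by $$[x,y]_n := \beta^n([x,y]), \qquad [x,y,z]_n := \beta^{2n}([x,y,z])$$ for all $x,y,z\in A$. Then $\mathcal{A}_n := (A, [\,,\,]_n, [\,,\,,\,]_n, \beta^{n+1})$ is a Hom-Akivis algebra.
   Context: All vector spaces are over a fixed ground field of characteristic $0$. For a linear self-map $\beta$, $\beta^k$ denotes the $k$-fold composition, with $\beta^0=\mathrm{Id}$. The symbol $\circlearrowleft_{x,y,z}$ denotes the sum over cyclic permutations of $x,y,z$. A Hom-Akivis algebra is a quadruple $(A, [\,,\,], [\,,\,,\,], \alpha)$ consisting of a vector space $A$, a skew-symmetric bilinear map $[\,,\,] : A^{\otimes 2} \to A$, a trilinear map $[\,,\,,\,] : A^{\otimes 3} \to A$ and a linear map $\alpha : A \to A$ such that for all $x,y,z \in A$ $$\circlearrowleft_{x,y,z} [[x,y], \alpha(z)] = \circlearrowleft_{x,y,z} [x,y,z] - \circlearrowleft_{x,y,z} [y,x,z].$$ It is called multiplicative if $\alpha([x,y]) = [\alpha(x),\alpha(y)]$ and $\alpha([x,y,z]) = [\alpha(x),\alpha(y),\alpha(z)]$ for all $x,y,z \in A$. *)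

theory Defs
  imports Complex_Main
begin

definition cyclic_sum :: "('a \<Rightarrow> 'a \<Rightarrow> 'a \<Rightarrow> 'b::ab_group_add) \<Rightarrow> 'a \<Rightarrow> 'a \<Rightarrow> 'a \<Rightarrow> 'b" where
  "cyclic_sum f x y z = f x y z + f y z x + f z x y"

(* A bilinear map A \<otimes> A \<rightarrow> A (resp. trilinear map) is rendered as a curried map that is linear
   in each argument separately. *)

definition bilinear_map ::
  "('k::field \<Rightarrow> 'a::ab_group_add \<Rightarrow> 'a) \<Rightarrow> ('a \<Rightarrow> 'a \<Rightarrow> 'a) \<Rightarrow> bool" where
  "bilinear_map scale f \<longleftrightarrow>
     (\<forall>y. Vector_Spaces.linear scale scale (\<lambda>x. f x y)) \<and>
     (\<forall>x. Vector_Spaces.linear scale scale (\<lambda>y. f x y))"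

definition trilinear_map ::
  "('k::field \<Rightarrow> 'a::ab_group_add \<Rightarrow> 'a) \<Rightarrow> ('a \<Rightarrow> 'a \<Rightarrow> 'a \<Rightarrow> 'a) \<Rightarrow> bool" where
  "trilinear_map scale f \<longleftrightarrow>
     (\<forall>y z. Vector_Spaces.linear scale scale (\<lambda>x. f x y z)) \<and>
     (\<forall>x z. Vector_Spaces.linear scale scale (\<lambda>y. f x y z)) \<and>
     (\<forall>x y. Vector_Spaces.linear scale scale (\<lambda>z. f x y z))"

locale hom_akivis_algebra = vector_space scale
  for scale :: "'k::field_char_0 \<Rightarrow> 'a::ab_group_add \<Rightarrow> 'a" +
  fixes br :: "'a \<Rightarrow> 'a \<Rightarrow> 'a"
    and tr :: "'a \<Rightarrow> 'a \<Rightarrow> 'a \<Rightarrow> 'a"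
    and \<alpha> :: "'a \<Rightarrow> 'a"
  assumes bilinear_br: "bilinear_map scale br"
    and skew_br: "\<And>x y. br x y = - br y x"
    and trilinear_tr: "trilinear_map scale tr"
    and linear_alpha: "Vector_Spaces.linear scale scale \<alpha>"
    and hom_akivis_identity:
      "\<And>x y z. cyclic_sum (\<lambda>x y z. br (br x y) (\<alpha> z)) x y z =
         cyclic_sum (\<lambda>x y z. tr x y z) x y z - cyclic_sum (\<lambda>x y z. tr y x z) x y z"

locale multiplicative_hom_akivis_algebra = hom_akivis_algebra scale br tr \<alpha>
  for scale :: "'k::field_char_0 \<Rightarrow> 'a::ab_group_add \<Rightarrow> 'a"
    and br :: "'a \<Rightarrow> 'a \<Rightarrow> 'a"
    and tr :: "'a \<Rightarrow> 'a \<Rightarrow> 'a \<Rightarrow> 'a"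
    and \<alpha> :: "'a \<Rightarrow> 'a" +
  assumes alpha_br: "\<And>x y. \<alpha> (br x y) = br (\<alpha> x) (\<alpha> y)"
    and alpha_tr: "\<And>x y z. \<alpha> (tr x y z) = tr (\<alpha> x) (\<alpha> y) (\<alpha> z)"

end

theory Submission
  imports Defs
begin

text \<open>
  Multiplicativity makes every power \<open>\<beta> ^^ k\<close> an endomorphism of both brackets, so a power
  of \<open>\<beta>\<close> can be pulled out of a bracket as soon as it acts on each argument. In a cyclic
  summand of the twisted left-hand side, \<open>\<beta>\<^sup>n [\<beta>\<^sup>n [x, y], \<beta>\<^sup>n\<^sup>+\<^sup>1 z]\<close>, each argument of the outer
  bracket carries \<open>\<beta>\<^sup>n\<close>; pulling it out gives \<open>\<beta>\<^sup>2\<^sup>n [[x, y], \<beta> z]\<close>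
  (\<open>twisted_double_bracket\<close>). This is why the bracket, the triple bracket and the twisting map
  are given the exponents \<open>n\<close>, \<open>2 n\<close> and \<open>n + 1\<close>: every term of the twisted identity is
  \<open>\<beta>\<^sup>2\<^sup>n\<close> of the corresponding term of the original one, and \<open>\<beta>\<^sup>2\<^sup>n\<close> is additive. Multilinearity
  and skew-symmetry are inherited because powers of \<open>\<beta>\<close> are linear.
\<close>

lemma (in vector_space) linear_funpow:
  assumes "Vector_Spaces.linear scale scale f"
  shows "Vector_Spaces.linear scale scale (f ^^ k)"
proof (induction k)
  case 0
  show ?case using linear_id by (simp add: id_def)
next
  case (Suc k)
  show ?case using Vector_Spaces.linear_compose[OF Suc.IH assms] by (simp only: funpow.simps)
qed

lemma bilinear_map_compose_linear:
  assumes "bilinear_map scale f" and "Vector_Spaces.linear scale scale g"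
  shows "bilinear_map scale (\<lambda>x y. g (f x y))"
  using assms Vector_Spaces.linear_compose[OF _ assms(2)]
  unfolding bilinear_map_def comp_def by blast

lemma trilinear_map_compose_linear:
  assumes "trilinear_map scale f" and "Vector_Spaces.linear scale scale g"
  shows "trilinear_map scale (\<lambda>x y z. g (f x y z))"
  using assms Vector_Spaces.linear_compose[OF _ assms(2)]
  unfolding trilinear_map_def comp_def by blast

lemma cyclic_sum_linear_image:
  assumes "Vector_Spaces.linear s t g"
  shows "cyclic_sum (\<lambda>x y z. g (f x y z)) x y z = g (cyclic_sum f x y z)"
proof -
  interpret g: Vector_Spaces.linear s t g by (rule assms)
  show ?thesis by (simp add: cyclic_sum_def g.add)
qed

context multiplicative_hom_akivis_algebra
begin

lemma funpow_alpha_br: "(\<alpha> ^^ k) (br x y) = br ((\<alpha> ^^ k) x) ((\<alpha> ^^ k) y)"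
  by (induction k) (simp_all add: alpha_br)

lemma twisted_double_bracket:
  "(\<alpha> ^^ n) (br ((\<alpha> ^^ n) (br x y)) ((\<alpha> ^^ (n + 1)) z)) = (\<alpha> ^^ (2 * n)) (br (br x y) (\<alpha> z))"
proof -
  have "br ((\<alpha> ^^ n) (br x y)) ((\<alpha> ^^ (n + 1)) z) = (\<alpha> ^^ n) (br (br x y) (\<alpha> z))"
    by (simp add: funpow_alpha_br funpow_swap1)
  then show ?thesis by (simp add: mult_2 funpow_add)
qed

end

theorem theorem2p9:
  fixes scale :: "'k::field_char_0 \<Rightarrow> 'a::ab_group_add \<Rightarrow> 'a"
    and br :: "'a \<Rightarrow> 'a \<Rightarrow> 'a"
    and tr :: "'a \<Rightarrow> 'a \<Rightarrow> 'a \<Rightarrow> 'a"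
    and \<beta> :: "'a \<Rightarrow> 'a"
    and n :: nat
  assumes "multiplicative_hom_akivis_algebra scale br tr \<beta>"
  shows "hom_akivis_algebra scale
           (\<lambda>x y. (\<beta> ^^ n) (br x y))
           (\<lambda>x y z. (\<beta> ^^ (2 * n)) (tr x y z))
           (\<beta> ^^ (n + 1))"
proof -
  interpret multiplicative_hom_akivis_algebra scale br tr \<beta> by (rule assms)
  note lin = linear_funpow[OF linear_alpha]
  interpret pow: Vector_Spaces.linear scale scale "\<beta> ^^ k" for k by (rule lin)
  show ?thesis
  proof (intro hom_akivis_algebra.intro hom_akivis_algebra_axioms.intro)
    show "vector_space scale" by (rule vector_space_axioms)
  next
    show "bilinear_map scale (\<lambda>x y. (\<beta> ^^ n) (br x y))"
      by (rule bilinear_map_compose_linear[OF bilinear_br lin])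
    show "trilinear_map scale (\<lambda>x y z. (\<beta> ^^ (2 * n)) (tr x y z))"
      by (rule trilinear_map_compose_linear[OF trilinear_tr lin])
    show "Vector_Spaces.linear scale scale (\<beta> ^^ (n + 1))"
      by (rule lin)
  next
    fix x y
    show "(\<beta> ^^ n) (br x y) = - (\<beta> ^^ n) (br y x)"
      using skew_br[of x y] by (simp add: pow.neg)
  next
    fix x y z
    show "cyclic_sum (\<lambda>x y z. (\<beta> ^^ n) (br ((\<beta> ^^ n) (br x y)) ((\<beta> ^^ (n + 1)) z))) x y z =
        cyclic_sum (\<lambda>x y z. (\<beta> ^^ (2 * n)) (tr x y z)) x y z -
        cyclic_sum (\<lambda>x y z. (\<beta> ^^ (2 * n)) (tr y x z)) x y z"
      by (simp only: twisted_double_bracket cyclic_sum_linear_image[OF lin]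
          hom_akivis_identity pow.diff)
  qed
qed

end
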